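(* The class of all simple digraphs with stability number at most two is not a well-quasi-order under minor containment.
   Context: All digraphs are finite (in general loops and parallel edges are allowed); an edge $uv$ has tail $u$ and head $v$. A digraph is simple if it is loopless and there is at most one edge $uv$ for every ordered pair of distinct vertices $u,v$ (so $uv$ and $vu$ may both be edges). The stability number of a digraph is the maximum size of an independent set in its underlying undirected graph. A digraph is strongly-connected if it is non-null and has a directed path from $u$ to $v$ for all vertices $u,v$. A class of digraphs is a well-quasi-order under minor containment if for every infinite sequence $G_1,G_2,\ldots$ of its members there exist $j>i\ge1$ such that $G_i$ is a minor of $G_j$. Minors: a digraph $H$ is a minor of a digraph $G$ if $H$ can be obtained from a subdigraph of $G$ by repeatedly contracting a strongly-connected subdigraph to a vertex. Equivalently, there is a minor mapping from $H$ to $G$, i.e. a mapping $\phi$ defined on $V(H)$ such that: (i) for every $v\in V(H)$, $\phi(v)$ is a non-null strongly-connected subdigraph of $G$; (ii) $\phi(u)$ and $\phi(v)$ are vertex-disjoint for distinct $u,v\in V(H)$; (iii) for all $u,v\in V(H)$ (not necessarily distinct), if there are $k$ edges of $H$ with tail $u$ and head $v$, then there are at least $k$ edges of $G$ with tail in $V(\phi(u))$ and head in $V(\phi(v))$ that are not contained in $E(\phi(x))$ for any $x\in V(H)$. *)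

theory Defs
  imports Graph_Theory.Graph_Theory
begin

(* Finite simple digraphs are the locale "digraph" of Graph_Theory: finite vertex and arc sets,
   no loops, no two arcs with the same tail and head. *)

definition stable_set :: "('a,'b) pre_digraph \<Rightarrow> 'a set \<Rightarrow> bool" where
  "stable_set G S \<longleftrightarrow> S \<subseteq> verts G \<and> (\<forall>u\<in>S. \<forall>v\<in>S. u \<noteq> v \<longrightarrow> \<not> u \<rightarrow>\<^bsub>G\<^esub> v)"

(* Meant for finite G: then the maximum is over a finite set, nonempty because the empty set
   is stable. *)
definition stability_number :: "('a,'b) pre_digraph \<Rightarrow> nat" where
  "stability_number G = Max (card ` {S. stable_set G S})"

(* The vertex that replaces S is named by some w in verts S; minors are taken up to isomorphism,
   so the choice of w is immaterial. Only the arcs of S disappear: any other arc with both ends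
   in S becomes a loop at w. *)
definition contract :: "('a,'b) pre_digraph \<Rightarrow> ('a,'b) pre_digraph \<Rightarrow> 'a \<Rightarrow> ('a,'b) pre_digraph" where
  "contract G S w =
    \<lparr> verts = insert w (verts G - verts S),
      arcs = arcs G - arcs S,
      tail = (\<lambda>e. if tail G e \<in> verts S then w else tail G e),
      head = (\<lambda>e. if head G e \<in> verts S then w else head G e) \<rparr>"

inductive contracts_to :: "('a,'b) pre_digraph \<Rightarrow> ('a,'b) pre_digraph \<Rightarrow> bool" for G where
  refl: "contracts_to G G"
| step: "\<lbrakk>contracts_to G K; subgraph S K; strongly_connected S; w \<in> verts S\<rbrakk>
    \<Longrightarrow> contracts_to G (contract K S w)"

definition minor :: "('c,'d) pre_digraph \<Rightarrow> ('a,'b) pre_digraph \<Rightarrow> bool" where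
  "minor H G \<longleftrightarrow> (\<exists>G' K. subgraph G' G \<and> contracts_to G' K \<and> digraph_iso K H)"

definition well_quasi_order_on :: "('g \<Rightarrow> 'g \<Rightarrow> bool) \<Rightarrow> 'g set \<Rightarrow> bool" where
  "well_quasi_order_on R C \<longleftrightarrow>
    (\<forall>G :: nat \<Rightarrow> 'g. (\<forall>i. G i \<in> C) \<longrightarrow> (\<exists>i j. i < j \<and> R (G i) (G j)))"

(* The description of minors by minor mappings; minor_iff_minor_mapping below shows that it agrees
   with minor on finite digraphs. *)
definition minor_mapping ::
    "('c \<Rightarrow> ('a,'b) pre_digraph) \<Rightarrow> ('c,'d) pre_digraph \<Rightarrow> ('a,'b) pre_digraph \<Rightarrow> bool" where
  "minor_mapping \<phi> H G \<longleftrightarrow>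
    (\<forall>v\<in>verts H. subgraph (\<phi> v) G \<and> strongly_connected (\<phi> v)) \<and>
    (\<forall>u\<in>verts H. \<forall>v\<in>verts H. u \<noteq> v \<longrightarrow> verts (\<phi> u) \<inter> verts (\<phi> v) = {}) \<and>
    (\<forall>u\<in>verts H. \<forall>v\<in>verts H.
      card {e \<in> arcs H. tail H e = u \<and> head H e = v} \<le>
      card {e \<in> arcs G. tail G e \<in> verts (\<phi> u) \<and> head G e \<in> verts (\<phi> v) \<and>
        (\<forall>x\<in>verts H. e \<notin> arcs (\<phi> x))})"

(* K arises from G by replacing the disjoint strongly connected subgraphs psi v by single vertices. *)
definition branch :: "('a \<Rightarrow> ('a,'b) pre_digraph) \<Rightarrow> ('a,'b) pre_digraph \<Rightarrow> ('a,'b) pre_digraph \<Rightarrow> bool" where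
  "branch \<psi> K G \<longleftrightarrow> wf_digraph K \<and>
    (\<forall>v\<in>verts K. subgraph (\<psi> v) G \<and> strongly_connected (\<psi> v)) \<and>
    (\<forall>u\<in>verts K. \<forall>v\<in>verts K. u \<noteq> v \<longrightarrow> verts (\<psi> u) \<inter> verts (\<psi> v) = {}) \<and>
    arcs K \<subseteq> arcs G \<and>
    (\<forall>e\<in>arcs K. tail G e \<in> verts (\<psi> (tail K e)) \<and> head G e \<in> verts (\<psi> (head K e)) \<and>
       (\<forall>v\<in>verts K. e \<notin> arcs (\<psi> v)))"

lemma wf_contract:
  assumes "wf_digraph K" "subgraph S K" "w \<in> verts S"
  shows "wf_digraph (contract K S w)"
  using assms by (auto simp: contract_def wf_digraph_def)

lemma branch_step:
  assumes B: "branch \<psi> K G" and G: "wf_digraph G"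
    and S: "subgraph S K" "strongly_connected S" "w \<in> verts S"
  shows "\<exists>\<psi>'. branch \<psi>' (contract K S w) G"
proof -
  define T where "T = \<lparr> verts = (\<Union>a\<in>verts S. verts (\<psi> a)),
     arcs = arcs S \<union> (\<Union>a\<in>verts S. arcs (\<psi> a)), tail = tail G, head = head G \<rparr>"
  have SK: "verts S \<subseteq> verts K" "arcs S \<subseteq> arcs K" "tail S = tail K" "head S = head K" and wS: "wf_digraph S"
    using S(1) by (auto simp: subgraph_def compatible_def)
  have wK: "wf_digraph K" using B by (simp add: branch_def)
  have sub: "subgraph (\<psi> v) G" "strongly_connected (\<psi> v)" if "v \<in> verts K" for v
    using B that by (auto simp: branch_def)
  have subD: "verts (\<psi> v) \<subseteq> verts G" "arcs (\<psi> v) \<subseteq> arcs G" "tail (\<psi> v) = tail G" "head (\<psi> v) = head G"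
    "wf_digraph (\<psi> v)"
    if "v \<in> verts K" for v using sub[OF that] by (auto simp: subgraph_def compatible_def)
  have aK: "arcs K \<subseteq> arcs G" using B by (auto simp: branch_def)
  have ends: "tail G e \<in> verts (\<psi> (tail K e))" "head G e \<in> verts (\<psi> (head K e))"
     "v \<in> verts K \<Longrightarrow> e \<notin> arcs (\<psi> v)"
    if "e \<in> arcs K" for e v using B that by (auto simp: branch_def)
  have endS: "tail S e \<in> verts S" "head S e \<in> verts S" if "e \<in> arcs S" for e
    using wS that by (auto simp: wf_digraph_def)
  have wfT: "wf_digraph T"
  proof
    fix e assume "e \<in> arcs T"
    then consider "e \<in> arcs S" | a where "a \<in> verts S" "e \<in> arcs (\<psi> a)" by (auto simp: T_def)
    then have "tail T e \<in> verts T \<and> head T e \<in> verts T"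
    proof cases
      case 1
      then show ?thesis using ends[of e] endS[of e] SK by (auto simp: T_def)
    next
      case 2
      then have "a \<in> verts K" using SK by auto
      with 2 subD[of a] show ?thesis by (auto simp: T_def wf_digraph_def)
    qed
    then show "tail T e \<in> verts T" "head T e \<in> verts T" by auto
  qed
  have TG: "subgraph T G"
    using wfT G SK aK subD by (auto simp: subgraph_def compatible_def T_def) blast+
  have \<psi>T: "subgraph (\<psi> a) T" if "a \<in> verts S" for a
    using that wfT subD[of a] SK by (auto simp: subgraph_def compatible_def T_def)
  have inn: "x \<rightarrow>\<^sup>*\<^bsub>T\<^esub> y" if "a \<in> verts S" "x \<in> verts (\<psi> a)" "y \<in> verts (\<psi> a)" for a x y
  proof -
    have "x \<rightarrow>\<^sup>*\<^bsub>\<psi> a\<^esub> y" using that sub(2)[of a] SK by (auto simp: strongly_connected_def)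
    then show ?thesis using pre_digraph.reachable_mono[OF _ \<psi>T[OF that(1)]] by blast
  qed
  have out: "\<forall>x\<in>verts (\<psi> a). \<forall>y\<in>verts (\<psi> b). x \<rightarrow>\<^sup>*\<^bsub>T\<^esub> y" if "a \<rightarrow>\<^sup>*\<^bsub>S\<^esub> b" for a b
    using that
  proof (induct rule: wf_digraph.reachable_induct[OF wS, consumes 1, case_names base step])
    case base then show ?case using inn by blast
  next
    case (step b c)
    from step(2) obtain e where e: "e \<in> arcs S" "tail S e = b" "head S e = c" by (rule reachableE)
    then have "tail G e \<in> verts (\<psi> b)" "head G e \<in> verts (\<psi> c)" using ends[of e] SK by auto
    moreover have "tail G e \<rightarrow>\<^bsub>T\<^esub> head G e" using e
      by (auto simp: T_def arcs_ends_def arc_to_ends_def)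
    moreover have "c \<in> verts S" using e endS by auto
    ultimately show ?case using step(3) inn
      by (meson wfT wf_digraph.reachable_adj_trans wf_digraph.reachable_trans)
  qed
  have Tne: "verts (\<psi> w) \<noteq> {}" using sub(2)[of w] S SK by (auto simp: strongly_connected_def)
  have scT: "strongly_connected T"
  proof (rule strongly_connectedI)
    show "verts T \<noteq> {}" using Tne S by (auto simp: T_def)
    fix u v assume "u \<in> verts T" "v \<in> verts T"
    then obtain a b where "a \<in> verts S" "b \<in> verts S" "u \<in> verts (\<psi> a)" "v \<in> verts (\<psi> b)"
      by (auto simp: T_def)
    then show "u \<rightarrow>\<^sup>*\<^bsub>T\<^esub> v" using out S(2) by (auto simp: strongly_connected_def)
  qed
  have dis: "verts (\<psi> u) \<inter> verts (\<psi> v) = {}" if "u \<in> verts K" "v \<in> verts K" "u \<noteq> v" for u v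
    using B that unfolding branch_def by blast
  let ?C = "contract K S w" and ?p = "\<psi>(w := T)"
  have vC: "verts ?C = insert w (verts K - verts S)" and aC: "arcs ?C = arcs K - arcs S"
    by (auto simp: contract_def)
  have "branch ?p ?C G"
    unfolding branch_def
  proof (intro conjI ballI impI)
    show "wf_digraph ?C" using wf_contract[OF wK S(1,3)] .
  next
    fix v assume "v \<in> verts ?C"
    then show "subgraph (?p v) G" "strongly_connected (?p v)"
      using sub TG scT vC by auto
  next
    fix u v assume uv: "u \<in> verts ?C" "v \<in> verts ?C" "u \<noteq> v"
    have *: "verts (\<psi> x) \<inter> verts T = {}" if "x \<in> verts K" "x \<notin> verts S" for x
    proof -
      have "verts (\<psi> x) \<inter> verts (\<psi> a) = {}" if "a \<in> verts S" for a
        using dis[of x a] \<open>x \<in> verts K\<close> \<open>x \<notin> verts S\<close> that SK(1) by blast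
      then show ?thesis by (auto simp: T_def)
    qed
    consider "u = w" "v \<noteq> w" | "u \<noteq> w" "v = w" | "u \<noteq> w" "v \<noteq> w" using uv by blast
    then show "verts (?p u) \<inter> verts (?p v) = {}"
    proof cases
      case 1 then show ?thesis using *[of v] uv vC by auto
    next
      case 2 then show ?thesis using *[of u] uv vC by auto
    next
      case 3 then show ?thesis using dis[of u v] uv vC by auto
    qed
  next
    show "arcs ?C \<subseteq> arcs G" using aC aK by auto
  next
    fix e assume e: "e \<in> arcs ?C"
    then have eK: "e \<in> arcs K" "e \<notin> arcs S" using aC by auto
    show "tail G e \<in> verts (?p (tail ?C e))" "head G e \<in> verts (?p (head ?C e))"
      using ends(1,2)[OF eK(1)] S(3) by (auto simp: contract_def T_def)
    fix v assume "v \<in> verts ?C"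
    then show "e \<notin> arcs (?p v)"
      using ends(3)[OF eK(1)] eK SK vC by (auto simp: T_def)
  qed
  then show ?thesis by blast
qed

lemma contracts_to_branch:
  assumes "contracts_to G K" "wf_digraph G"
  shows "\<exists>\<psi>. branch \<psi> K G"
  using assms
proof induct
  case refl
  let ?p = "\<lambda>v. \<lparr> verts = {v}, arcs = {}, tail = tail G, head = head G \<rparr>"
  have "subgraph (?p v) G \<and> strongly_connected (?p v)" if "v \<in> verts G" for v
  proof -
    have "wf_digraph (?p v)" by (simp add: wf_digraph_def)
    then show ?thesis using that refl
      by (simp add: subgraph_def compatible_def strongly_connected_def wf_digraph.reachable_refl)
  qed
  then have "branch ?p G G"
    using refl by (simp add: branch_def wf_digraph_def)
  then show ?case by (rule exI[of _ ?p])
next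
  case (step K S w)
  from step(2)[OF step.prems] obtain \<psi> where "branch \<psi> K G" by (elim exE)
  from branch_step[OF this step.prems step(3,4,5)] show ?case .
qed

lemma subgraph_trans':
  assumes "subgraph A B" "subgraph B C" shows "subgraph A C"
  using assms by (auto simp: subgraph_def compatible_def)

lemma minor_imp_mapping:
  assumes "minor H G" "finite (arcs G)"
  shows "\<exists>\<phi>. minor_mapping \<phi> H G"
proof -
  from assms(1) obtain G' K where 1: "subgraph G' G" "contracts_to G' K" "digraph_iso K H"
    by (auto simp: minor_def)
  then have G': "wf_digraph G'" by (simp add: subgraph_def)
  obtain \<psi> where B: "branch \<psi> K G'" using contracts_to_branch[OF 1(2) G'] by blast
  have wK: "wf_digraph K" using B by (simp add: branch_def)
  obtain f where f: "pre_digraph.digraph_isomorphism K f" "H = app_iso f K"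
    using 1(3) by (auto simp: digraph_iso_def)
  define g where "g = the_inv_into (verts K) (iso_verts f)"
  have inj: "inj_on (iso_verts f) (verts K)" and inja: "inj_on (iso_arcs f) (arcs K)"
    and ie: "\<And>a. a \<in> arcs K \<Longrightarrow> iso_verts f (tail K a) = iso_tail f (iso_arcs f a)
        \<and> iso_verts f (head K a) = iso_head f (iso_arcs f a)"
    using f(1) by (auto simp: pre_digraph.digraph_isomorphism_def)
  have gf: "g (iso_verts f v) = v" if "v \<in> verts K" for v
    using the_inv_into_f_f[OF inj that] by (simp add: g_def)
  have tG: "tail G' = tail G" "head G' = head G" "arcs G' \<subseteq> arcs G" using 1 by (auto simp: subgraph_def compatible_def)
  have "minor_mapping (\<psi> \<circ> g) H G"
    unfolding minor_mapping_def
  proof (intro conjI ballI impI)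
    fix v assume "v \<in> verts H"
    then obtain v' where v': "v' \<in> verts K" "v = iso_verts f v'" using f by auto
    then show "subgraph ((\<psi> \<circ> g) v) G" "strongly_connected ((\<psi> \<circ> g) v)"
      using B gf 1(1) by (auto simp: branch_def intro: subgraph_trans')
  next
    fix u v assume "u \<in> verts H" "v \<in> verts H" "u \<noteq> v"
    moreover then obtain u' v' where v': "v' \<in> verts K" "v = iso_verts f v'" "u' \<in> verts K" "u = iso_verts f u'" using f by auto
    ultimately have "u' \<noteq> v'" by auto
    then have "verts (\<psi> u') \<inter> verts (\<psi> v') = {}" using B v' unfolding branch_def by blast
    then show "verts ((\<psi> \<circ> g) u) \<inter> verts ((\<psi> \<circ> g) v) = {}" using v' gf by simp
  next
    fix u v assume "u \<in> verts H" "v \<in> verts H"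
    then obtain u' v' where v': "v' \<in> verts K" "v = iso_verts f v'" "u' \<in> verts K" "u = iso_verts f u'" using f by auto
    let ?A = "{e \<in> arcs H. tail H e = u \<and> head H e = v}"
    let ?B = "{e \<in> arcs G. tail G e \<in> verts ((\<psi> \<circ> g) u) \<and> head G e \<in> verts ((\<psi> \<circ> g) v) \<and>
        (\<forall>x\<in>verts H. e \<notin> arcs ((\<psi> \<circ> g) x))}"
    have "?A \<subseteq> iso_arcs f ` ?B"
    proof
      fix e assume e: "e \<in> ?A"
      then obtain a where a: "a \<in> arcs K" "e = iso_arcs f a" using f by auto
      have "iso_verts f (tail K a) = u" "iso_verts f (head K a) = v" using ie[OF a(1)] e a f by auto
      then have "g u = tail K a" "g v = head K a" using gf a(1) wK by (auto simp: wf_digraph_def)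
      moreover have "tail G a \<in> verts (\<psi> (tail K a)) \<and> head G a \<in> verts (\<psi> (head K a)) \<and>
       (\<forall>v\<in>verts K. a \<notin> arcs (\<psi> v)) \<and> a \<in> arcs G" using B a tG by (auto simp: branch_def)
      ultimately have "a \<in> ?B" using f gf by auto
      then show "e \<in> iso_arcs f ` ?B" using a by blast
    qed
    moreover have "finite ?B" using assms(2) by simp
    ultimately show "card ?A \<le> card ?B" by (rule surj_card_le[rotated])
  qed
  then show ?thesis by (intro exI)
qed

lemma contract_all:
  assumes G: "wf_digraph G" and fin: "finite A"
    and sub: "\<And>v. v \<in> A \<Longrightarrow> subgraph (\<phi> v) G \<and> strongly_connected (\<phi> v)"
    and dis: "\<And>u v. u \<in> A \<Longrightarrow> v \<in> A \<Longrightarrow> u \<noteq> v \<Longrightarrow> verts (\<phi> u) \<inter> verts (\<phi> v) = {}"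
    and r: "\<And>v. v \<in> A \<Longrightarrow> r v \<in> verts (\<phi> v)"
  shows "\<exists>K. contracts_to G K \<and> wf_digraph K \<and>
    verts K = (verts G - (\<Union>v\<in>A. verts (\<phi> v))) \<union> r ` A \<and>
    arcs K = arcs G - (\<Union>v\<in>A. arcs (\<phi> v)) \<and>
    (\<forall>e. \<forall>v\<in>A. tail G e \<in> verts (\<phi> v) \<longrightarrow> tail K e = r v) \<and>
    (\<forall>e. \<forall>v\<in>A. head G e \<in> verts (\<phi> v) \<longrightarrow> head K e = r v) \<and>
    (\<forall>e. (\<forall>v\<in>A. tail G e \<notin> verts (\<phi> v)) \<longrightarrow> tail K e = tail G e) \<and>
    (\<forall>e. (\<forall>v\<in>A. head G e \<notin> verts (\<phi> v)) \<longrightarrow> head K e = head G e)"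
  using fin sub dis r
proof (induct A rule: finite_induct)
  case empty
  then show ?case using G by (auto intro!: exI[of _ G] contracts_to.refl)
next
  case (insert a A)
  obtain K where KK: "contracts_to G K" "wf_digraph K"
    "verts K = (verts G - (\<Union>v\<in>A. verts (\<phi> v))) \<union> r ` A"
    "arcs K = arcs G - (\<Union>v\<in>A. arcs (\<phi> v))"
    "\<forall>e. \<forall>v\<in>A. tail G e \<in> verts (\<phi> v) \<longrightarrow> tail K e = r v"
    "\<forall>e. \<forall>v\<in>A. head G e \<in> verts (\<phi> v) \<longrightarrow> head K e = r v"
    "\<forall>e. (\<forall>v\<in>A. tail G e \<notin> verts (\<phi> v)) \<longrightarrow> tail K e = tail G e"
    "\<forall>e. (\<forall>v\<in>A. head G e \<notin> verts (\<phi> v)) \<longrightarrow> head K e = head G e"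
    apply (rule exE[OF insert(3)])
        apply (rule insert.prems(1), erule insertI2)
       apply (rule insert.prems(2), erule insertI2, erule insertI2, assumption)
      apply (rule insert.prems(3), erule insertI2)
     apply (elim conjE)
    apply (rule that)
           apply assumption+
    done
  have K5: "tail K e = r v" if "v \<in> A" "tail G e \<in> verts (\<phi> v)" for e v using KK(5) that by simp
  have K6: "head K e = r v" if "v \<in> A" "head G e \<in> verts (\<phi> v)" for e v using KK(6) that by simp
  have K7: "tail K e = tail G e" if "\<forall>v\<in>A. tail G e \<notin> verts (\<phi> v)" for e using KK(7) that by simp
  have K8: "head K e = head G e" if "\<forall>v\<in>A. head G e \<notin> verts (\<phi> v)" for e using KK(8) that by simp
  note K = KK(1-4) K5 K6 K7 K8
  have da: "verts (\<phi> a) \<inter> verts (\<phi> v) = {}" if "v \<in> A" for v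
    using insert.prems(2)[of a v] insert(2) that by auto
  have sa: "verts (\<phi> a) \<subseteq> verts G" "arcs (\<phi> a) \<subseteq> arcs G" "tail (\<phi> a) = tail G" "head (\<phi> a) = head G" "wf_digraph (\<phi> a)"
    using insert.prems(1)[of a] by (auto simp: subgraph_def compatible_def)
  have wfv: "tail G e \<in> verts (\<phi> v)" if "v \<in> A" "e \<in> arcs (\<phi> v)" for e v
    using insert.prems(1)[of v] that by (auto simp: subgraph_def compatible_def wf_digraph_def)
  have wfa: "tail G e \<in> verts (\<phi> a)" "head G e \<in> verts (\<phi> a)" if "e \<in> arcs (\<phi> a)" for e
    using sa that by (auto simp: wf_digraph_def)
  have tK: "tail K e = tail G e" if "tail G e \<in> verts (\<phi> a)" for e
    using K(7) that da by blast
  have hK: "head K e = head G e" if "head G e \<in> verts (\<phi> a)" for e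
    using K(8) that da by blast
  define S where "S = \<lparr> verts = verts (\<phi> a), arcs = arcs (\<phi> a), tail = tail K, head = head K \<rparr>"
  have vK: "verts (\<phi> a) \<subseteq> verts K" using sa da K(3) by blast
  have aK: "arcs (\<phi> a) \<subseteq> arcs K"
  proof
    fix e assume e: "e \<in> arcs (\<phi> a)"
    then have "e \<notin> arcs (\<phi> v)" if "v \<in> A" for v using wfa[OF e] wfv[OF that] da[OF that] by blast
    then show "e \<in> arcs K" using e sa K(4) by auto
  qed
  have wfS: "wf_digraph S" using wfa tK hK by (auto simp: S_def wf_digraph_def)
  have SK: "subgraph S K" using vK aK wfS K(2) by (auto simp: S_def subgraph_def compatible_def)
  have "arcs_ends S = arcs_ends (\<phi> a)"
    using wfa tK hK sa by (auto simp: S_def arcs_ends_def arc_to_ends_def image_def)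
  then have scS: "strongly_connected S" using insert.prems(1)[of a]
    by (auto simp: strongly_connected_def reachable_def S_def)
  have ra: "r a \<in> verts S" using insert.prems(3) by (auto simp: S_def)
  let ?C = "contract K S (r a)"
  have rv: "r v \<notin> verts (\<phi> a)" if "v \<in> A" for v using insert.prems(3)[of v] da[OF that] that by blast
  show ?case
  proof (intro exI[of _ ?C] conjI allI ballI impI)
    show "contracts_to G ?C" using contracts_to.step[OF K(1) SK scS ra] .
    show "wf_digraph ?C" using wf_contract[OF K(2) SK ra] .
    show "verts ?C = verts G - (\<Union>v\<in>insert a A. verts (\<phi> v)) \<union> r ` insert a A"
      using rv K(3) by (auto simp: contract_def S_def)
    show "arcs ?C = arcs G - (\<Union>v\<in>insert a A. arcs (\<phi> v))"
      using K(4) by (auto simp: contract_def S_def)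
  next
    fix e v assume v: "v \<in> insert a A" "tail G e \<in> verts (\<phi> v)"
    show "tail ?C e = r v"
    proof (cases "v = a")
      case True then show ?thesis using v tK[of e] by (auto simp: contract_def S_def)
    next
      case False then show ?thesis using v K(5)[of v e] rv[of v] by (auto simp: contract_def S_def)
    qed
  next
    fix e v assume v: "v \<in> insert a A" "head G e \<in> verts (\<phi> v)"
    show "head ?C e = r v"
    proof (cases "v = a")
      case True then show ?thesis using v hK[of e] by (auto simp: contract_def S_def)
    next
      case False then show ?thesis using v K(6)[of v e] rv[of v] by (auto simp: contract_def S_def)
    qed
  next
    fix e assume "\<forall>v\<in>insert a A. tail G e \<notin> verts (\<phi> v)"
    then show "tail ?C e = tail G e" using K(7)[of e] by (auto simp: contract_def S_def)
  next
    fix e assume "\<forall>v\<in>insert a A. head G e \<notin> verts (\<phi> v)"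
    then show "head ?C e = head G e" using K(8)[of e] by (auto simp: contract_def S_def)
  qed
qed

lemma mapping_imp_minor:
  assumes M: "minor_mapping \<phi> H G" and G: "fin_digraph G" and H: "fin_digraph H"
  shows "minor H G"
proof -
  interpret H: fin_digraph H by fact
  interpret G: fin_digraph G by fact
  let ?A = "\<lambda>u v. {e \<in> arcs H. tail H e = u \<and> head H e = v}"
  let ?B = "\<lambda>u v. {e \<in> arcs G. tail G e \<in> verts (\<phi> u) \<and> head G e \<in> verts (\<phi> v) \<and>
        (\<forall>x\<in>verts H. e \<notin> arcs (\<phi> x))}"
  have sub: "subgraph (\<phi> v) G \<and> strongly_connected (\<phi> v)" if "v \<in> verts H" for v
    using M that by (auto simp: minor_mapping_def)
  have dis: "verts (\<phi> u) \<inter> verts (\<phi> v) = {}" if "u \<in> verts H" "v \<in> verts H" "u \<noteq> v" for u v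
    using M that unfolding minor_mapping_def by blast
  define j where "j u v = (SOME j. inj_on j (?A u v) \<and> j ` ?A u v \<subseteq> ?B u v)" for u v
  have j: "inj_on (j u v) (?A u v) \<and> j u v ` ?A u v \<subseteq> ?B u v" if "u \<in> verts H" "v \<in> verts H" for u v
  proof -
    have c: "card (?A u v) \<le> card (?B u v)" using M that by (auto simp: minor_mapping_def)
    have "finite (?A u v)" "finite (?B u v)" by simp_all
    from card_le_inj[OF this c] obtain i where "i ` ?A u v \<subseteq> ?B u v" "inj_on i (?A u v)" by (elim exE conjE)
    then have "\<exists>j. inj_on j (?A u v) \<and> j ` ?A u v \<subseteq> ?B u v" by (intro exI[of _ i] conjI)
    then show ?thesis unfolding j_def by (rule someI_ex)
  qed
  define k where "k e = j (tail H e) (head H e) e" for e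
  have kB: "k e \<in> ?B (tail H e) (head H e)" if "e \<in> arcs H" for e
  proof -
    have "tail H e \<in> verts H" "head H e \<in> verts H" using that by auto
    from j[OF this] have "j (tail H e) (head H e) ` ?A (tail H e) (head H e) \<subseteq> ?B (tail H e) (head H e)" by (rule conjunct2)
    moreover have "e \<in> ?A (tail H e) (head H e)" using that by simp
    ultimately show ?thesis unfolding k_def by (rule subsetD[OF _ imageI])
  qed
  have injk: "inj_on k (arcs H)"
  proof (rule inj_onI)
    fix e e' assume e: "e \<in> arcs H" "e' \<in> arcs H" "k e = k e'"
    have "tail H e = tail H e'"
      using kB[OF e(1)] kB[OF e(2)] e dis[of "tail H e" "tail H e'"] by auto
    moreover have "head H e = head H e'"
      using kB[OF e(1)] kB[OF e(2)] e dis[of "head H e" "head H e'"] by auto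
    ultimately show "e = e'" using e j[of "tail H e" "head H e"]
      by (auto simp: k_def dest: inj_onD)
  qed
  define G' where "G' = \<lparr> verts = (\<Union>v\<in>verts H. verts (\<phi> v)),
     arcs = k ` arcs H \<union> (\<Union>v\<in>verts H. arcs (\<phi> v)), tail = tail G, head = head G \<rparr>"
  have subD: "verts (\<phi> v) \<subseteq> verts G" "arcs (\<phi> v) \<subseteq> arcs G" "tail (\<phi> v) = tail G" "head (\<phi> v) = head G"
    "wf_digraph (\<phi> v)"
    if "v \<in> verts H" for v using sub[OF that] by (auto simp: subgraph_def compatible_def)
  have wG': "wf_digraph G'"
  proof
    fix e assume "e \<in> arcs G'"
    then consider a where "a \<in> arcs H" "e = k a" | v where "v \<in> verts H" "e \<in> arcs (\<phi> v)" by (auto simp: G'_def)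
    then have "tail G e \<in> verts G' \<and> head G e \<in> verts G'"
    proof cases
      case 1 then show ?thesis using kB[of a] H.wellformed[of a] by (auto simp: G'_def)
    next
      case 2 then show ?thesis using subD[of v] by (auto simp: G'_def wf_digraph_def)
    qed
    then show "tail G' e \<in> verts G'" "head G' e \<in> verts G'" by (auto simp: G'_def)
  qed
  have "arcs G' \<subseteq> arcs G" using kB subD(2) by (auto simp: G'_def dest!: subD(2))
  moreover have "verts G' \<subseteq> verts G" using subD(1) by (auto simp: G'_def)
  ultimately have G'G: "subgraph G' G" using wG' G.wf_digraph by (auto simp: subgraph_def compatible_def G'_def)
  have sub': "subgraph (\<phi> v) G' \<and> strongly_connected (\<phi> v)" if "v \<in> verts H" for v
    using sub[OF that] subD[OF that] that wG' by (auto simp: subgraph_def compatible_def G'_def)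
  define r where "r v = (SOME x. x \<in> verts (\<phi> v))" for v
  have r: "r v \<in> verts (\<phi> v)" if "v \<in> verts H" for v
    using sub[OF that] unfolding r_def by (auto simp: strongly_connected_def some_in_eq)
  obtain K where KK: "contracts_to G' K" "wf_digraph K"
    "verts K = (verts G' - (\<Union>v\<in>verts H. verts (\<phi> v))) \<union> r ` verts H"
    "arcs K = arcs G' - (\<Union>v\<in>verts H. arcs (\<phi> v))"
    "\<forall>e. \<forall>v\<in>verts H. tail G' e \<in> verts (\<phi> v) \<longrightarrow> tail K e = r v"
    "\<forall>e. \<forall>v\<in>verts H. head G' e \<in> verts (\<phi> v) \<longrightarrow> head K e = r v"
    apply (rule exE[OF contract_all[where A = "verts H" and \<phi> = \<phi> and r = r, OF wG' H.finite_verts]])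
        apply (erule sub')
       apply (erule dis, assumption, assumption)
      apply (erule r)
     apply (elim conjE)
    apply (rule that)
         apply assumption+
    done
  note K = KK(1-4)
  have injr: "inj_on r (verts H)" 
  proof (rule inj_onI)
    fix u v assume "u \<in> verts H" "v \<in> verts H" "r u = r v"
    then show "u = v" using r[of u] r[of v] dis[of u v] by auto
  qed
  have vK: "verts K = r ` verts H" using K(3) by (auto simp: G'_def)
  have aK: "arcs K = k ` arcs H" using K(4) kB by (auto simp: G'_def)
  have ek: "tail K (k e) = r (tail H e)" "head K (k e) = r (head H e)" if "e \<in> arcs H" for e
    using KK(5)[rule_format, of "tail H e" "k e"] KK(6)[rule_format, of "head H e" "k e"] kB[OF that] that by (auto simp: G'_def)
  let ?f = "\<lparr> iso_verts = the_inv_into (verts H) r, iso_arcs = the_inv_into (arcs H) k,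
     iso_head = head H, iso_tail = tail H \<rparr>"
  have "pre_digraph.digraph_isomorphism K ?f"
    unfolding pre_digraph.digraph_isomorphism_def
    using K(2) vK aK ek injr injk by (auto simp: the_inv_into_f_f inj_on_the_inv_into)
  moreover have "H = app_iso ?f K"
    using vK aK injr injk by (auto simp: app_iso_def the_inv_into_f_f image_image cong: image_cong)
  ultimately have "digraph_iso K H" unfolding digraph_iso_def by blast
  then show ?thesis using G'G K(1) unfolding minor_def by blast
qed

lemma minor_iff_minor_mapping:
  assumes "fin_digraph G" "fin_digraph H"
  shows "minor H G \<longleftrightarrow> (\<exists>\<phi>. minor_mapping \<phi> H G)"
proof
  assume "minor H G"
  then show "\<exists>\<phi>. minor_mapping \<phi> H G"
    by (rule minor_imp_mapping) (rule fin_digraph.finite_arcs[OF assms(1)])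
next
  assume "\<exists>\<phi>. minor_mapping \<phi> H G"
  then obtain \<phi> where "minor_mapping \<phi> H G" by (elim exE)
  then show "minor H G" using assms by (rule mapping_imp_minor)
qed

end

theory Submission
  imports Defs "HOL-Library.Nat_Bijection"
begin

text \<open>
  An infinite antichain comes from a single idea: cycles of different lengths are incomparable as
  subgraphs, and a cycle can be hidden in a digraph of stability number two in such a way
  that minor mappings have no freedom to contract anything.

  The digraph \<open>cycle_digraph n\<close> consists of two transitive tournaments \<open>A\<close> and \<open>B\<close> on \<open>n\<close> vertices
  each, and a digon (two vertices joined by arcs both ways). All arcs from \<open>A\<close> to the digon and
  from the digon to \<open>B\<close> are present, while the arcs from \<open>A\<close> to \<open>B\<close> form a cycle of length
  \<open>2 * n\<close> in the underlying graph. Since \<open>A\<close> with the digon is a clique and \<open>B\<close> is a clique, no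
  three vertices are independent. The only directed cycle is the digon, so strongly connected
  subdigraphs with more than one vertex live on the digon (\<open>strongly_connected_subgraph_cases\<close>).

  A minor mapping from \<open>cycle_digraph m\<close> to \<open>cycle_digraph n\<close> must therefore send digon to digon,
  using both of its vertices, and every other vertex to a single vertex outside the digon. The
  digon separates \<open>A\<close> from \<open>B\<close>: in-neighbours of the digon go to \<open>A\<close>, and out-neighbours to \<open>B\<close>.
  (Without a digon the whole digraph would be acyclic, and would embed in a large
  transitive tournament.) Hence the \<open>2 * m\<close>-cycle is mapped injectively into the \<open>2 * n\<close>-cycle,
  which is impossible for \<open>2 \<le> m < n\<close> (\<open>no_shorter_cycle\<close>).
\<close>

section \<open>Cycles do not contain shorter cycles\<close>

text \<open>
  The cycle of length \<open>2 * n\<close> is the bipartite graph in which \<open>i\<close> on the left is adjacent to \<open>i\<close>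
  and \<open>Suc i mod n\<close> on the right. The image of a shorter cycle would have minimum degree two,
  and so it would be closed under taking neighbours, hence be everything.
\<close>

lemma no_shorter_cycle:
  fixes f g :: "nat \<Rightarrow> nat"
  assumes m: "2 \<le> m"
    and f: "inj_on f {..<m}" "\<And>i. i < m \<Longrightarrow> f i < n"
    and g: "inj_on g {..<m}"
    and same: "\<And>i. i < m \<Longrightarrow> g i = f i \<or> g i = Suc (f i) mod n"
    and succ: "\<And>i. i < m \<Longrightarrow> g (Suc i mod m) = f i \<or> g (Suc i mod m) = Suc (f i) mod n"
  shows "n \<le> m"
proof -
  have neq: "Suc i mod m \<noteq> i" if "i < m" for i
    using m that by (auto simp: mod_Suc)
  have inj_succ: "p = q" if "Suc p mod n = Suc q mod n" "p < n" "q < n" for p q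
    using that by (auto simp: mod_Suc split: if_splits)
  have right: "Suc (f i) mod n \<in> g ` {..<m}" if "i < m" for i
  proof -
    have s: "Suc i mod m < m" using m by simp
    then have "g i \<noteq> g (Suc i mod m)" using inj_onD[OF g(1)] neq[OF that] that by fastforce
    then have "Suc (f i) mod n = g i \<or> Suc (f i) mod n = g (Suc i mod m)"
      using same[OF that] succ[OF that] by auto
    then show ?thesis using s that by auto
  qed
  have left: "g j \<in> f ` {..<m}" if "j < m" for j
  proof -
    define i where "i = (if j = 0 then m - 1 else j - 1)"
    have i: "i < m" "Suc i mod m = j"
      using m that by (auto simp: i_def)
    have "f i \<noteq> f j" using inj_onD[OF f(1), of i j] neq[OF i(1)] i that by auto
    then have "g j = f j \<or> g j = f i"
      using same[OF that] succ[OF i(1)] inj_succ[of "f i" "f j"] f(2)[of i] f(2)[of j] i that by auto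
    then show ?thesis using i that by auto
  qed
  have step: "Suc p mod n \<in> f ` {..<m}" if "p \<in> f ` {..<m}" for p
    using that left right by fastforce
  have walk: "(f 0 + k) mod n \<in> f ` {..<m}" for k
  proof (induction k)
    case 0
    then show ?case using f(2)[of 0] m by auto
  next
    case (Suc k)
    from step[OF Suc] show ?case by (simp add: mod_Suc_eq)
  qed
  have "{..<n} \<subseteq> f ` {..<m}"
  proof
    fix p assume "p \<in> {..<n}"
    then have "(f 0 + (n - f 0 + p)) mod n = p" using f(2)[of 0] m by auto
    then show "p \<in> f ` {..<m}" using walk by metis
  qed
  then show ?thesis
    using surj_card_le[of "{..<m}" "{..<n}" f] by simp
qed

section \<open>The digraphs\<close>

text \<open>
  The vertices below \<open>n\<close> are \<open>A\<close>, those above \<open>n + 1\<close> are \<open>B\<close>, and \<open>n\<close>, \<open>n + 1\<close> is the digon.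
  With this numbering all arcs go upwards, apart from one arc of the digon.
\<close>

definition cycle_arc :: "nat \<Rightarrow> nat \<Rightarrow> nat \<Rightarrow> bool" where
  "cycle_arc n u v \<longleftrightarrow> u < 2 * n + 2 \<and> v < 2 * n + 2 \<and>
    (u < v \<and> (u < n \<and> n + 1 < v \<longrightarrow> v = n + 2 + u \<or> v = n + 2 + Suc u mod n)
     \<or> u = n + 1 \<and> v = n)"

definition cycle_digraph :: "nat \<Rightarrow> (nat, nat) pre_digraph" where
  "cycle_digraph n =
    \<lparr> verts = {..<2 * n + 2},
      arcs = {e. cycle_arc n (fst (prod_decode e)) (snd (prod_decode e))},
      tail = fst \<circ> prod_decode,
      head = snd \<circ> prod_decode \<rparr>"

lemma verts_cycle_digraph [simp]: "verts (cycle_digraph n) = {..<2 * n + 2}"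
  by (simp add: cycle_digraph_def)

lemma arcs_cycle_digraph:
  "e \<in> arcs (cycle_digraph n) \<longleftrightarrow>
    cycle_arc n (tail (cycle_digraph n) e) (head (cycle_digraph n) e)"
  by (simp add: cycle_digraph_def)

lemma adj_cycle_digraph: "u \<rightarrow>\<^bsub>cycle_digraph n\<^esub> v \<longleftrightarrow> cycle_arc n u v"
proof
  assume "cycle_arc n u v"
  then show "u \<rightarrow>\<^bsub>cycle_digraph n\<^esub> v"
    by (auto simp: cycle_digraph_def arcs_ends_def arc_to_ends_def image_iff
        intro!: exI[of _ "prod_encode (u, v)"])
qed (auto simp: cycle_digraph_def arcs_ends_def arc_to_ends_def, metis fst_conv snd_conv)

lemma cycle_arcD: "cycle_arc n u v \<Longrightarrow> u < v \<or> u = n + 1 \<and> v = n"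
  by (auto simp: cycle_arc_def)

lemma digraph_cycle_digraph: "digraph (cycle_digraph n)"
proof
  fix e assume "e \<in> arcs (cycle_digraph n)"
  then have e: "cycle_arc n (tail (cycle_digraph n) e) (head (cycle_digraph n) e)"
    by (simp add: arcs_cycle_digraph)
  then show "tail (cycle_digraph n) e \<in> verts (cycle_digraph n)"
    "head (cycle_digraph n) e \<in> verts (cycle_digraph n)"
    by (auto simp: cycle_arc_def)
  show "tail (cycle_digraph n) e \<noteq> head (cycle_digraph n) e"
    using cycle_arcD[OF e] by auto
next
  show "finite (verts (cycle_digraph n))" by simp
  have "arcs (cycle_digraph n) \<subseteq> prod_encode ` ({..<2 * n + 2} \<times> {..<2 * n + 2})"
  proof
    fix e assume "e \<in> arcs (cycle_digraph n)"
    then have "prod_decode e \<in> {..<2 * n + 2} \<times> {..<2 * n + 2}"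
      by (simp add: cycle_digraph_def cycle_arc_def mem_Times_iff)
    then show "e \<in> prod_encode ` ({..<2 * n + 2} \<times> {..<2 * n + 2})"
      by (metis imageI prod_decode_inverse)
  qed
  then show "finite (arcs (cycle_digraph n))" by (rule finite_subset) simp
next
  fix e1 e2
  assume "arc_to_ends (cycle_digraph n) e1 = arc_to_ends (cycle_digraph n) e2"
  then show "e1 = e2"
    by (auto simp: cycle_digraph_def arc_to_ends_def)
qed

text \<open>\<open>A\<close> together with the digon is a clique, and so is \<open>B\<close>.\<close>

lemma stability_number_cycle_digraph: "stability_number (cycle_digraph n) \<le> 2"
proof -
  have "card S \<le> 2" if S: "stable_set (cycle_digraph n) S" for S
  proof -
    have sub: "S \<subseteq> {..<2 * n + 2}" using S by (simp add: stable_set_def)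
    then have fin: "finite S" by (rule finite_subset) simp
    have no: "\<not> cycle_arc n u v" if "u \<in> S" "v \<in> S" "u < v" for u v
      using S that by (auto simp: stable_set_def adj_cycle_digraph)
    have clique: "card T \<le> 1" if T: "T \<subseteq> S" "T \<subseteq> {..<n + 2} \<or> T \<subseteq> {n + 2..}" for T
    proof -
      have "\<not> u < v" if "u \<in> T" "v \<in> T" for u v
        using no[of u v] T sub that by (force simp: cycle_arc_def)
      then have "\<forall>u\<in>T. \<forall>v\<in>T. u = v" by (meson linorder_neqE_nat)
      then show ?thesis
        using card_le_Suc0_iff_eq[OF finite_subset[OF T(1) fin]] by simp
    qed
    have "S = (S \<inter> {..<n + 2}) \<union> (S \<inter> {n + 2..})" by auto
    then have "card S \<le> card (S \<inter> {..<n + 2}) + card (S \<inter> {n + 2..})"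
      by (metis card_Un_le)
    then show ?thesis using clique[of "S \<inter> {..<n + 2}"] clique[of "S \<inter> {n + 2..}"] by simp
  qed
  moreover have "finite {S. stable_set (cycle_digraph n) S}"
    by (rule finite_subset[of _ "Pow {..<2 * n + 2}"]) (auto simp: stable_set_def)
  moreover have "stable_set (cycle_digraph n) {}" by (simp add: stable_set_def)
  ultimately show ?thesis unfolding stability_number_def by (subst Max_le_iff) auto
qed

section \<open>Rigidity of minor mappings\<close>

lemma reachable_cycle_digraph:
  assumes "u \<rightarrow>\<^sup>*\<^bsub>cycle_digraph n\<^esub> v"
  shows "u \<le> v \<or> u = n + 1 \<and> v = n"
proof -
  interpret digraph "cycle_digraph n" by (rule digraph_cycle_digraph)
  from assms show ?thesis
  proof (induct rule: reachable_induct)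
    case base
    then show ?case by simp
  next
    case (step v w)
    then show ?case using cycle_arcD[of n v w] by (auto simp: adj_cycle_digraph)
  qed
qed

lemma strongly_connected_subgraph_cases:
  assumes "subgraph S (cycle_digraph n)" "strongly_connected S" "u \<in> verts S" "v \<in> verts S"
  shows "u = v \<or> u \<in> {n, n + 1} \<and> v \<in> {n, n + 1}"
proof -
  have "u \<rightarrow>\<^sup>*\<^bsub>S\<^esub> v" "v \<rightarrow>\<^sup>*\<^bsub>S\<^esub> u"
    using assms by (auto simp: strongly_connected_def)
  then have "u \<rightarrow>\<^sup>*\<^bsub>cycle_digraph n\<^esub> v" "v \<rightarrow>\<^sup>*\<^bsub>cycle_digraph n\<^esub> u"
    using assms(1) by (auto intro: pre_digraph.reachable_mono)
  then show ?thesis using reachable_cycle_digraph[of n u v] reachable_cycle_digraph[of n v u] by auto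
qed

lemma minor_mapping_arc:
  assumes "minor_mapping \<phi> H G" "fin_digraph H" "u \<in> verts H" "v \<in> verts H" "u \<rightarrow>\<^bsub>H\<^esub> v"
  shows "\<exists>p\<in>verts (\<phi> u). \<exists>q\<in>verts (\<phi> v). p \<rightarrow>\<^bsub>G\<^esub> q"
proof -
  interpret fin_digraph H by fact
  let ?A = "{e \<in> arcs H. tail H e = u \<and> head H e = v}"
  let ?B = "{e \<in> arcs G. tail G e \<in> verts (\<phi> u) \<and> head G e \<in> verts (\<phi> v) \<and>
        (\<forall>x\<in>verts H. e \<notin> arcs (\<phi> x))}"
  have "?A \<noteq> {}" using assms(5) by (auto simp: arcs_ends_def arc_to_ends_def)
  then have "0 < card ?A" by (simp add: card_gt_0_iff)
  also have "card ?A \<le> card ?B" using assms(1,3,4) by (simp add: minor_mapping_def)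
  finally have "?B \<noteq> {}" by (metis card.empty less_irrefl)
  then obtain e where "e \<in> ?B" by blast
  then show ?thesis by (force simp: arcs_ends_def arc_to_ends_def)
qed

text \<open>
  The two vertices of the digon need different branch sets with arcs both ways between them,
  which fit only into the digon. This leaves single vertices \<open>h v\<close> for all other \<open>v\<close>, and being
  adjacent to or from the digon tells \<open>A\<close> from \<open>B\<close>; so \<open>h\<close> restricts to an embedding of cycles.
\<close>

lemma cycle_digraph_not_minor:
  assumes m: "2 \<le> m" and less: "m < n"
  shows "\<not> minor (cycle_digraph m) (cycle_digraph n)"
proof
  interpret H: digraph "cycle_digraph m" by (rule digraph_cycle_digraph)
  interpret G: digraph "cycle_digraph n" by (rule digraph_cycle_digraph)
  assume "minor (cycle_digraph m) (cycle_digraph n)"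
  then obtain \<phi> where \<phi>: "minor_mapping \<phi> (cycle_digraph m) (cycle_digraph n)"
    using minor_imp_mapping G.finite_arcs by blast
  have ne: "verts (\<phi> v) \<noteq> {}" if "v < 2 * m + 2" for v
    using \<phi> that by (auto simp: minor_mapping_def strongly_connected_def)
  have strong: "p = q \<or> p \<in> {n, n + 1} \<and> q \<in> {n, n + 1}"
    if "v < 2 * m + 2" "p \<in> verts (\<phi> v)" "q \<in> verts (\<phi> v)" for v p q
    using strongly_connected_subgraph_cases[of "\<phi> v" n p q] \<phi> that
    by (auto simp: minor_mapping_def)
  have same: "u = v" if "p \<in> verts (\<phi> u)" "p \<in> verts (\<phi> v)" "u < 2 * m + 2" "v < 2 * m + 2" for p u v
  proof (rule ccontr)
    assume "u \<noteq> v"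
    then have "verts (\<phi> u) \<inter> verts (\<phi> v) = {}"
      using \<phi> that(3,4) by (simp add: minor_mapping_def)
    then show False using that(1,2) by blast
  qed
  have arc: "\<exists>p\<in>verts (\<phi> u). \<exists>q\<in>verts (\<phi> v). cycle_arc n p q" if "cycle_arc m u v" for u v
  proof -
    have "u \<in> verts (cycle_digraph m)" "v \<in> verts (cycle_digraph m)"
      using that by (auto simp: cycle_arc_def)
    from minor_mapping_arc[OF \<phi> H.fin_digraph_axioms this] show ?thesis
      using that by (simp add: adj_cycle_digraph)
  qed

  have digon: "verts (\<phi> m) \<union> verts (\<phi> (m + 1)) = {n, n + 1}"
  proof -
    have "cycle_arc m m (m + 1)" "cycle_arc m (m + 1) m" by (auto simp: cycle_arc_def)
    then obtain p q p' q' where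
      pq: "p \<in> verts (\<phi> m)" "q \<in> verts (\<phi> (m + 1))" "cycle_arc n p q"
      and pq': "p' \<in> verts (\<phi> m)" "q' \<in> verts (\<phi> (m + 1))" "cycle_arc n q' p'"
      using arc by meson
    have dist: "r \<noteq> s" if "r \<in> verts (\<phi> m)" "s \<in> verts (\<phi> (m + 1))" for r s
      using same[of r m "m + 1"] that by auto
    have "p = p' \<or> p \<in> {n, n + 1} \<and> p' \<in> {n, n + 1}" "q = q' \<or> q \<in> {n, n + 1} \<and> q' \<in> {n, n + 1}"
      using strong[of m p p'] strong[of "m + 1" q q'] pq pq' by auto
    moreover have "p \<noteq> q" "p \<noteq> q'" "p' \<noteq> q" "p' \<noteq> q'" using dist pq pq' by auto
    \<comment> \<open>If \<open>p \<noteq> p'\<close>, then \<open>\<phi> m\<close> uses up the digon, so \<open>q = q'\<close> and both arcs at \<open>q\<close> go upwards,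
      which puts \<open>q\<close> strictly between \<open>n\<close> and \<open>n + 1\<close>; likewise if \<open>q \<noteq> q'\<close>.
      What remains is a pair of opposite arcs.\<close>
    ultimately have pq_eq: "{p, q} = {n, n + 1}"
      using cycle_arcD[OF pq(3)] cycle_arcD[OF pq'(3)] by auto
    have "r = p" if "r \<in> verts (\<phi> m)" for r
      using strong[of m r p] dist[of r q] pq pq_eq that by auto
    then have 1: "verts (\<phi> m) = {p}" using pq by blast
    have "r = q" if "r \<in> verts (\<phi> (m + 1))" for r
      using strong[of "m + 1" r q] dist[of p r] pq pq_eq that by auto
    then have 2: "verts (\<phi> (m + 1)) = {q}" using pq by blast
    show "verts (\<phi> m) \<union> verts (\<phi> (m + 1)) = {n, n + 1}" using 1 2 pq_eq by auto
  qed
  have off: "r \<notin> {n, n + 1}" if "v < 2 * m + 2" "v \<notin> {m, m + 1}" "r \<in> verts (\<phi> v)" for r v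
    using same[of r v m] same[of r v "m + 1"] that digon by auto

  define h where "h v = the_elem (verts (\<phi> v))" for v
  have h: "verts (\<phi> v) = {h v}" if "v < 2 * m + 2" "v \<notin> {m, m + 1}" for v
  proof -
    have "verts (\<phi> v) \<noteq> {}" using ne that by simp
    then obtain r where "r \<in> verts (\<phi> v)" by blast
    then have "verts (\<phi> v) = {r}" using strong[of v r] off[of v r] that by blast
    then show ?thesis by (simp add: h_def)
  qed
  have A: "h i < n" if "i < m" for i
  proof -
    have "cycle_arc m i m" using that by (auto simp: cycle_arc_def)
    from arc[OF this] have "\<exists>q\<in>verts (\<phi> m). cycle_arc n (h i) q"
      using h[of i] that by simp
    then obtain q where "q \<in> {n, n + 1}" "cycle_arc n (h i) q" using digon by blast
    then show ?thesis using off[of i "h i"] h[of i] that cycle_arcD[of n "h i" q] by auto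
  qed
  have B: "n + 2 \<le> h (m + 2 + j)" if "j < m" for j
  proof -
    have "cycle_arc m m (m + 2 + j)" using that by (auto simp: cycle_arc_def)
    from arc[OF this] have "\<exists>q\<in>verts (\<phi> m). cycle_arc n q (h (m + 2 + j))"
      using h[of "m + 2 + j"] that by simp
    then obtain q where "q \<in> {n, n + 1}" "cycle_arc n q (h (m + 2 + j))" using digon by blast
    then show ?thesis
      using off[of "m + 2 + j" "h (m + 2 + j)"] h[of "m + 2 + j"] that
        cycle_arcD[of n q "h (m + 2 + j)"] by auto
  qed
  have AB: "h (m + 2 + j) = n + 2 + h i \<or> h (m + 2 + j) = n + 2 + Suc (h i) mod n"
    if "i < m" "j < m" "j = i \<or> j = Suc i mod m" for i j
  proof -
    have "cycle_arc m i (m + 2 + j)" using that by (auto simp: cycle_arc_def)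
    from arc[OF this] have "cycle_arc n (h i) (h (m + 2 + j))"
      using h[of i] h[of "m + 2 + j"] that by simp
    then show ?thesis using A[of i] B[of j] that by (auto simp: cycle_arc_def)
  qed
  have inj: "u = v" if "h u = h v" "u < 2 * m + 2" "v < 2 * m + 2" "u \<notin> {m, m + 1}" "v \<notin> {m, m + 1}" for u v
    using same[of "h u" u v] h[of u] h[of v] that by auto

  have "n \<le> m"
  proof (rule no_shorter_cycle[OF m, where f = h and g = "\<lambda>j. h (m + 2 + j) - (n + 2)"])
    show "inj_on h {..<m}" by (rule inj_onI) (rule inj, auto)
    show "inj_on (\<lambda>j. h (m + 2 + j) - (n + 2)) {..<m}"
    proof (rule inj_onI)
      fix i j assume "i \<in> {..<m}" "j \<in> {..<m}" "h (m + 2 + i) - (n + 2) = h (m + 2 + j) - (n + 2)"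
      then show "i = j" using inj[of "m + 2 + i" "m + 2 + j"] B[of i] B[of j] by auto
    qed
    fix i assume i: "i < m"
    show "h i < n" using A[OF i] .
    show "h (m + 2 + i) - (n + 2) = h i \<or> h (m + 2 + i) - (n + 2) = Suc (h i) mod n"
      using AB[of i i] i by auto
    show "h (m + 2 + Suc i mod m) - (n + 2) = h i \<or>
        h (m + 2 + Suc i mod m) - (n + 2) = Suc (h i) mod n"
      using AB[of i "Suc i mod m"] i by auto
  qed
  then show False using less by simp
qed

theorem mainTheorem7:
  shows "\<not> well_quasi_order_on minor
    {G :: (nat, nat) pre_digraph. digraph G \<and> stability_number G \<le> 2}"
proof
  assume "well_quasi_order_on minor
    {G :: (nat, nat) pre_digraph. digraph G \<and> stability_number G \<le> 2}"
  then obtain i j where "i < j" "minor (cycle_digraph (i + 2)) (cycle_digraph (j + 2))"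
    using digraph_cycle_digraph stability_number_cycle_digraph
    unfolding well_quasi_order_on_def
    by (elim allE[of _ "\<lambda>i. cycle_digraph (i + 2)"]) auto
  then show False using cycle_digraph_not_minor[of "i + 2" "j + 2"] by simp
qed

end
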